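(* Let $(X,d)$ be a complete Menger convex metric space with property $(B')$ whose distance function $d$ is Menger convex, and let $x,y$ be two distinct points of $X$. If the metric interval $[x,y]$ is convex, then every $(\alpha,\beta,\gamma)$-generalized hybrid mapping $T:[x,y]\to[x,y]$ has a fixed point.
   Context: For a metric space $(X,d)$, $x\in X$, $r\ge 0$, write $B[x,r]=\{y\in X: d(x,y)\le r\}$. For $x,y\in X$ and $t\in(0,1)$ put $c(x,y,t)=B[x,t\,d(x,y)]\cap B[y,(1-t)d(x,y)]$. $(X,d)$ is Menger convex if $c(x,y,t)\neq\emptyset$ for all $x,y\in X$ and all $t\in(0,1)$. The metric interval is $[x,y]=\bigcup_{0\le t\le 1}\big(B[x,t\,d(x,y)]\cap B[y,(1-t)d(x,y)]\big)$. A subset $A$ of a Menger convex metric space is convex if for all $u,v\in A$ and $0<r<d(u,v)$ one has $B[u,r]\cap B[v,d(u,v)-r]\subset A$. For nonempty subsets $A,B$ of $X$, the Hausdorff distance is $H(A,B)=\max\{\sup_{x\in A}d(x,B),\ \sup_{x\in B}d(x,A)\}$, where $d(x,A)=\inf_{y\in A}d(x,y)$. Property $(B')$: for all $x,y,z\in X$ and $t\in(0,1)$, $H(c(x,y,t),c(z,y,t))\le t\,d(x,z)$. The distance function $d$ is Menger convex if for each $u\in X$, all $x,y\in X$, $t\in(0,1)$ and $z\in c(x,y,t)$, one has $d(u,z)\le(1-t)d(u,x)+t\,d(u,y)$. For a nonempty subset $U$ of a Menger convex metric space, $T:U\to U$ is $(\alpha,\beta,\gamma)$-generalized hybrid if there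 are $\alpha,\beta,\gamma\in\mathbb R$ such that for all $x,y,z\in U$, $$\alpha\, d(Tx,Ty)^2+(1-\alpha)\,d(x,Ty)^2+\gamma\, d(Ty,z)^2\le \beta\, d(Tx,y)^2+(1-\beta+\gamma)\,d(x,y)^2+(1+\gamma)\,d(y,z)^2.$$
   Formalization: Property (B') as printed, with factor t, holds only in one-point spaces (take z = y, t = 1/4), contradicting x ≠ y; the formal theorem assumes either the printed (B') or the corrected bound H(c(x,y,t),c(z,y,t)) ≤ (1−t) d(x,z). *)

theory Defs
  imports "HOL-Analysis.Analysis"
begin

text \<open>
  The metric space \<open>X\<close> is the carrier of a type of class \<^class>\<open>metric_space\<close>.  Properties of the
  whole space take the type as an argument of type \<open>'a itself\<close>.
\<close>

definition menger_between :: "'a::metric_space \<Rightarrow> 'a \<Rightarrow> real \<Rightarrow> 'a set" where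
  "menger_between x y t = cball x (t * dist x y) \<inter> cball y ((1 - t) * dist x y)"

definition menger_convex :: "'a::metric_space itself \<Rightarrow> bool" where
  "menger_convex _ \<longleftrightarrow> (\<forall>x y :: 'a. \<forall>t\<in>{0<..<1}. menger_between x y t \<noteq> {})"

definition metric_interval :: "'a::metric_space \<Rightarrow> 'a \<Rightarrow> 'a set" where
  "metric_interval x y = (\<Union>t\<in>{0..1}. menger_between x y t)"

definition menger_convex_set :: "'a::metric_space set \<Rightarrow> bool" where
  "menger_convex_set A \<longleftrightarrow>
     (\<forall>u\<in>A. \<forall>v\<in>A. \<forall>r. 0 < r \<and> r < dist u v \<longrightarrow> cball u r \<inter> cball v (dist u v - r) \<subseteq> A)"

text \<open>
  The suprema are taken in the extended reals, so that the distance of unbounded sets is \<open>\<infinity>\<close>.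
  Only nonempty arguments are meaningful, since \<^const>\<open>infdist\<close> to the empty set is \<open>0\<close>.
\<close>

definition hausdorff_distance :: "'a::metric_space set \<Rightarrow> 'a set \<Rightarrow> ereal" where
  "hausdorff_distance A B =
     max (SUP x\<in>A. ereal (infdist x B)) (SUP x\<in>B. ereal (infdist x A))"

text \<open>
  Property (B'), verbatim from the source.  With \<open>menger_between x y t\<close> lying at distance \<open>t * dist x y\<close>
  from \<open>x\<close>, the factor \<open>t\<close> goes with the wrong end point: the lemma
  \<open>property_B'_printed_trivial\<close> below shows that only one-point spaces satisfy it.  The theorem
  accepts this version or \<open>property_B'\<close> below.
\<close>

definition property_B'_printed :: "'a::metric_space itself \<Rightarrow> bool" where
  "property_B'_printed _ \<longleftrightarrow>
     (\<forall>x y z :: 'a. \<forall>t\<in>{0<..<1}.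
        hausdorff_distance (menger_between x y t) (menger_between z y t) \<le> ereal (t * dist x z))"

text \<open>
  Property (B') with the factor that fits the parametrization of \<^const>\<open>menger_between\<close>.  Since
  \<open>menger_between x y t = menger_between y x (1 - t)\<close>, it is the same as requiring that the Hausdorff distance
  of \<open>menger_between y x t\<close> and \<open>menger_between y z t\<close> be at most \<open>t * dist x z\<close>.
\<close>

definition property_B' :: "'a::metric_space itself \<Rightarrow> bool" where
  "property_B' _ \<longleftrightarrow>
     (\<forall>x y z :: 'a. \<forall>t\<in>{0<..<1}.
        hausdorff_distance (menger_between x y t) (menger_between z y t) \<le> ereal ((1 - t) * dist x z))"

definition menger_convex_dist :: "'a::metric_space itself \<Rightarrow> bool" where
  "menger_convex_dist _ \<longleftrightarrow>
     (\<forall>u x y :: 'a. \<forall>t\<in>{0<..<1}. \<forall>z\<in>menger_between x y t.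
        dist u z \<le> (1 - t) * dist u x + t * dist u y)"

definition generalized_hybrid ::
  "real \<Rightarrow> real \<Rightarrow> real \<Rightarrow> 'a::metric_space set \<Rightarrow> ('a \<Rightarrow> 'a) \<Rightarrow> bool" where
  "generalized_hybrid \<alpha> \<beta> \<gamma> U T \<longleftrightarrow>
     U \<noteq> {} \<and> T \<in> U \<rightarrow> U \<and>
     (\<forall>x\<in>U. \<forall>y\<in>U. \<forall>z\<in>U.
        \<alpha> * (dist (T x) (T y))\<^sup>2 + (1 - \<alpha>) * (dist x (T y))\<^sup>2 + \<gamma> * (dist (T y) z)\<^sup>2
        \<le> \<beta> * (dist (T x) y)\<^sup>2 + (1 - \<beta> + \<gamma>) * (dist x y)\<^sup>2 + (1 + \<gamma>) * (dist y z)\<^sup>2)"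

lemma property_B'_printed_trivial:
  fixes x z :: "'a::metric_space"
  assumes "menger_convex TYPE('a)" and "property_B'_printed TYPE('a)"
  shows "x = z"
proof (rule ccontr)
  assume "x \<noteq> z"
  then have pos: "dist x z > 0" by simp
  obtain p where p: "p \<in> menger_between x z (1/4)"
    using assms(1) unfolding menger_convex_def by (fastforce dest: spec[of _ x] spec[of _ z])
  have z: "menger_between z z (1/4) = {z}" by (auto simp: menger_between_def)
  have "ereal (infdist p {z}) \<le> hausdorff_distance (menger_between x z (1/4)) (menger_between z z (1/4))"
    unfolding hausdorff_distance_def z using p by (intro max.coboundedI1 SUP_upper)
  also have "\<dots> \<le> ereal (1/4 * dist x z)"
    using assms(2) unfolding property_B'_printed_def 
    by (elim allE[of _ x] allE[of _ z] bspec) simp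
  finally have "dist p z \<le> 1/4 * dist x z" by simp
  moreover have "dist x p \<le> 1/4 * dist x z" using p by (simp add: menger_between_def)
  moreover have "dist x z \<le> dist x p + dist p z" by (rule dist_triangle)
  ultimately show False using pos by linarith
qed

lemma property_B'_if_printed:
  assumes "menger_convex TYPE('a::metric_space)" and "property_B'_printed TYPE('a)"
  shows "property_B' TYPE('a)"
  unfolding property_B'_def
proof (intro allI ballI)
  fix x y z :: 'a and t :: real
  assume "t \<in> {0<..<1}"
  then have "hausdorff_distance (menger_between x y t) (menger_between z y t) \<le> ereal (t * dist x z)"
    using assms(2) unfolding property_B'_printed_def by blast
  moreover have "x = z" using assms by (rule property_B'_printed_trivial)
  ultimately show "hausdorff_distance (menger_between x y t) (menger_between z y t) \<le> ereal ((1 - t) * dist x z)"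
    by simp
qed

end

theory Submission
  imports Defs
begin

text \<open>
  Property (B') alone makes metric intervals one-dimensional.  Let \<open>p\<close>, \<open>z\<close> lie at distance \<open>A\<close> from
  \<open>x\<close> and \<open>B\<close> from \<open>y\<close>, with \<open>A + B = d(x,y)\<close>.  If, up to an arbitrarily small error, a point of
  \<open>[x,p]\<close> is at distance \<open>\<alpha>\<close> from both \<open>p\<close> and \<open>z\<close>, then (B') yields a point of \<open>[z,y]\<close> at distance
  \<open>\<beta>\<close> from both, where \<open>1/\<beta> = 1/\<alpha> + 1/B\<close>.  Exchanging the end points and iterating from
  \<open>\<alpha> = A\<close> drives the distances to \<open>0\<close>, so \<open>p = z\<close>.  Hence \<open>d(x,\<cdot>)\<close> is an isometry of \<open>[x,y]\<close>
  onto a real interval.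

  On a real interval, for \<open>\<gamma> \<le> 0\<close> a cluster point \<open>l\<close> of the Cesaro means of an orbit is fixed: average
  the inequality along the orbit with \<open>y = l\<close> and \<open>z \<in> {l, T l}\<close>.  For \<open>\<gamma> > 0\<close>, if \<open>T\<close> had no fixed
  point, the jump of \<open>T\<close> at \<open>sup {x. T x > x}\<close> would force
  \<open>\<beta> - \<alpha> \<ge> 2\<bar>\<alpha>\<bar> + 1 + \<gamma>\<close>, and then \<open>y = z = T x\<close> shows that the displacement \<open>\<bar>T x - x\<bar>\<close> grows
  geometrically along orbits.
\<close>

section \<open>Consequences of (B') for pairs of points on a metric interval\<close>

lemma property_B'_approx:
  fixes x y z p :: "'a::metric_space"
  assumes "menger_convex TYPE('a)" and "property_B' TYPE('a)" and t: "t \<in> {0<..<1}"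
    and p: "p \<in> menger_between x y t" and "\<kappa> > 0"
  obtains q where "q \<in> menger_between z y t" and "dist p q < (1 - t) * dist x z + \<kappa>"
proof -
  have ne: "menger_between z y t \<noteq> {}"
    using assms unfolding menger_convex_def by blast
  have "ereal (infdist p (menger_between z y t))
      \<le> hausdorff_distance (menger_between x y t) (menger_between z y t)"
    unfolding hausdorff_distance_def using p by (intro max.coboundedI1 SUP_upper)
  also have "\<dots> \<le> ereal ((1 - t) * dist x z)"
    using assms unfolding property_B'_def by blast
  finally have "infdist p (menger_between z y t) < (1 - t) * dist x z + \<kappa>"
    using \<open>\<kappa> > 0\<close> by simp
  \<comment> \<open>The infimum need not be attained, so a point is chosen within the slack
    \<open>\<kappa>\<close>; all estimates up to uniqueness carry such an error.\<close>
  then have "(INF q\<in>menger_between z y t. dist p q) < (1 - t) * dist x z + \<kappa>"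
    using ne by (simp add: infdist_def)
  then obtain q where "q \<in> menger_between z y t" "dist p q < (1 - t) * dist x z + \<kappa>"
    using ne by (subst (asm) cINF_less_iff) (auto intro!: bdd_belowI2[of _ 0])
  then show thesis by (rule that)
qed

text \<open>The point \<open>p\<close> divides \<open>[a,y]\<close> in the ratio
  \<open>\<alpha> : B\<close>, so (B') compares it with a point \<open>b\<close> dividing
  \<open>[z,y]\<close> in the same ratio. The distance \<open>t * B\<close> from \<open>b\<close> to
  \<open>z\<close> and the main term \<open>(1 - t) * \<alpha>\<close> in the bound on
  \<open>dist p b\<close> are the same number. The conclusion thus has the shape of the hypothesis
  on \<open>a\<close>, with \<open>x\<close> and \<open>y\<close>, \<open>p\<close> and
  \<open>z\<close>, \<open>A\<close> and \<open>B\<close> exchanged, so the step can be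
  iterated.\<close>

lemma property_B'_half_step:
  fixes x y p z a :: "'a::metric_space"
  assumes mc: "menger_convex TYPE('a)" and B': "property_B' TYPE('a)"
    and pos: "A > 0" "B > 0" "\<alpha> > 0" "\<kappa> > 0"
    and xy: "dist x y = A + B" and "dist x p = A" "dist p y = B" "dist x z = A" "dist z y = B"
    and a: "dist a p = \<alpha>" "dist x a = A - \<alpha>" "dist z a \<le> \<alpha> + \<kappa>"
  obtains b where "dist b z = \<alpha> * B / (\<alpha> + B)" and "dist y b = B - \<alpha> * B / (\<alpha> + B)"
    and "dist p b \<le> \<alpha> * B / (\<alpha> + B) + 2 * \<kappa>"
proof -
  define t where "t = \<alpha> / (\<alpha> + B)"
  have t: "t \<in> {0<..<1}" using pos by (simp add: t_def)
  have tB: "t * B = \<alpha> * B / (\<alpha> + B)" "(1 - t) * \<alpha> = \<alpha> * B / (\<alpha> + B)"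
    "t * (\<alpha> + B) = \<alpha>" "(1 - t) * (\<alpha> + B) = B"
    using pos by (simp_all add: t_def field_simps)
  \<comment> \<open>The upper bound goes through \<open>p\<close>; the lower bound holds because
    \<open>a\<close> is \<open>A - \<alpha>\<close> away from \<open>x\<close>.\<close>
  have "dist a y = \<alpha> + B"
    using dist_triangle[of a y p] dist_triangle[of x y a] assms by linarith
  then have "p \<in> menger_between a y t"
    unfolding menger_between_def using assms tB by (simp add: dist_commute)
  then obtain b where b: "b \<in> menger_between z y t" "dist p b < (1 - t) * dist a z + \<kappa>"
    using property_B'_approx[OF mc B' t _ \<open>\<kappa> > 0\<close>] by metis
  have "(1 - t) * dist a z \<le> (1 - t) * (\<alpha> + \<kappa>)"
    using a t by (intro mult_left_mono) (auto simp: dist_commute)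
  also have "\<dots> \<le> \<alpha> * B / (\<alpha> + B) + \<kappa>"
    unfolding distrib_left tB using t pos by simp
  \<comment> \<open>One \<open>\<kappa>\<close> comes from the hypothesis on
    \<open>dist z a\<close>, the other from the choice of \<open>b\<close>.\<close>
  finally have 1: "dist p b \<le> \<alpha> * B / (\<alpha> + B) + 2 * \<kappa>" using b(2) by linarith
  have "dist z b \<le> t * B" "dist y b \<le> (1 - t) * B"
    using b(1) \<open>dist z y = B\<close> by (simp_all add: menger_between_def)
  moreover have "(1 - t) * B = B - t * B" by (simp add: algebra_simps)
  ultimately have "dist b z = t * B" "dist y b = B - t * B"
    using dist_triangle[of z y b] \<open>dist z y = B\<close> by (auto simp: dist_commute)
  with 1 show thesis by (intro that) (simp_all add: tB)
qed

text \<open>Each half step adds \<open>1/A\<close> or \<open>1/B\<close>, hence at least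
  \<open>1/M\<close>, to the reciprocal of the distance, which gives the bound
  \<open>M / real (Suc n)\<close>. Since the end points alternate, \<open>M\<close> has to bound
  both \<open>A\<close> and \<open>B\<close>. The induction starts with
  \<open>a = x\<close>.\<close>

lemma approx_common_predecessor:
  fixes x y p z :: "'a::metric_space"
  assumes mc: "menger_convex TYPE('a)" and B': "property_B' TYPE('a)"
    and "0 < A" "A \<le> M" "0 < B" "B \<le> M" "\<kappa> > 0"
    and "dist x y = A + B" "dist x p = A" "dist p y = B" "dist x z = A" "dist z y = B"
  shows "\<exists>a \<alpha>. 0 < \<alpha> \<and> \<alpha> \<le> M / real (Suc n) \<and>
    dist a p = \<alpha> \<and> dist x a = A - \<alpha> \<and> dist z a \<le> \<alpha> + \<kappa>"
  using assms(3-)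
proof (induction n arbitrary: x y p z A B \<kappa>)
  case 0
  then show ?case by (intro exI[of _ x] exI[of _ A]) (simp add: dist_commute)
next
  case (Suc n)
  \<comment> \<open>The induction hypothesis is used with the end points exchanged, and with
    \<open>\<kappa>/2\<close> because the half step doubles the error.\<close>
  obtain b \<beta> where \<beta>: "0 < \<beta>" "\<beta> \<le> M / real (Suc n)"
    and b: "dist b z = \<beta>" "dist y b = B - \<beta>" "dist p b \<le> \<beta> + \<kappa> / 2"
    using Suc.IH[of B A "\<kappa>/2" y x z p] Suc.prems
    by (simp only: dist_commute[of y] dist_commute[of _ x] add.commute[of B A] half_gt_zero) blast
  obtain a where a: "dist a p = \<beta> * A / (\<beta> + A)" "dist x a = A - \<beta> * A / (\<beta> + A)"
     "dist z a \<le> \<beta> * A / (\<beta> + A) + 2 * (\<kappa> / 2)"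
    by (rule property_B'_half_step[OF mc B', of B A \<beta> "\<kappa>/2" y x z p b])
      (use Suc.prems \<beta> b in \<open>simp_all add: dist_commute add.commute\<close>)
  \<comment> \<open>This is \<open>1/\<beta> + 1/A \<ge> (n + 2)/M\<close> with denominators
    cleared.\<close>
  have "real (Suc (Suc n)) * (\<beta> * A) = real (Suc n) * \<beta> * A + \<beta> * A"
    by (simp add: algebra_simps)
  also have "\<dots> \<le> M * A + \<beta> * M"
    using \<beta> Suc.prems by (intro add_mono mult_mono mult_left_mono) (auto simp: field_simps)
  finally have "\<beta> * A / (\<beta> + A) \<le> M / real (Suc (Suc n))"
    using \<beta> Suc.prems by (simp add: divide_simps) (simp add: algebra_simps)
  moreover have "0 < \<beta> * A / (\<beta> + A)" using \<beta> Suc.prems by simp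
  ultimately show ?case using a by (intro exI[of _ a] exI[of _ "\<beta> * A / (\<beta> + A)"]) simp
qed

section \<open>Metric intervals as isometric copies of real intervals\<close>

lemma metric_interval_iff:
  "p \<in> metric_interval x y \<longleftrightarrow> dist x p + dist p y = dist x y"
proof
  assume "p \<in> metric_interval x y"
  then obtain t where "dist x p \<le> t * dist x y" "dist y p \<le> (1 - t) * dist x y"
    by (auto simp: metric_interval_def menger_between_def)
  then show "dist x p + dist p y = dist x y"
    using dist_triangle[of x y p] by (simp add: dist_commute algebra_simps)
next
  assume *: "dist x p + dist p y = dist x y"
  show "p \<in> metric_interval x y"
  proof (cases "x = y")
    case True
    then have "p = y" using * by (simp add: dist_commute)
    then show ?thesis using True by (auto simp: metric_interval_def menger_between_def)
  next
    case False
    define t where "t = dist x p / dist x y"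
    have "t * dist x y = dist x p" using False by (simp add: t_def)
    moreover from this have "(1 - t) * dist x y = dist p y"
      using * by (simp add: left_diff_distrib)
    moreover have "t \<in> {0..1}"
    proof -
      have "0 < dist x y" "dist x p \<le> dist x y"
        using * False zero_le_dist[of p y] by (simp, linarith)
      then show ?thesis by (simp add: t_def)
    qed
    ultimately have "t \<in> {0..1}" "p \<in> menger_between x y t"
      by (auto simp: menger_between_def dist_commute)
    then show ?thesis unfolding metric_interval_def by blast
  qed
qed

lemma metric_interval_unique:
  fixes x y p z :: "'a::metric_space"
  assumes mc: "menger_convex TYPE('a)" and B': "property_B' TYPE('a)"
    and p: "p \<in> metric_interval x y" and z: "z \<in> metric_interval x y"
    and eq: "dist x p = dist x z"
  shows "p = z"
proof (cases "dist x p = 0 \<or> dist p y = 0")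
  case True
  then show ?thesis using p z eq by (auto simp: metric_interval_iff)
next
  case False
  define M where "M = max (dist x p) (dist p y)"
  have "dist p z \<le> 2 * (M / real (Suc n)) + \<kappa>" if \<kappa>: "\<kappa> > 0" for n \<kappa>
  proof -
    have "dist x y = dist x p + dist p y" "dist x z = dist x p" "dist z y = dist p y"
      using p z eq unfolding metric_interval_iff by linarith+
    moreover have "0 < dist x p" "0 < dist p y" using False by auto
    moreover have "dist x p \<le> M" "dist p y \<le> M" by (simp_all add: M_def)
    ultimately obtain a \<alpha> where "\<alpha> \<le> M / real (Suc n)" "dist a p = \<alpha>" "dist z a \<le> \<alpha> + \<kappa>"
      using approx_common_predecessor[OF mc B' _ _ _ _ \<kappa>, of "dist x p" M "dist p y" x y p z n]
      by blast
    then show ?thesis using dist_triangle[of p z a] by (simp add: dist_commute)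
  qed
  \<comment> \<open>First \<open>\<kappa>\<close> tends to 0 with \<open>n\<close> fixed, then
    \<open>n\<close> tends to infinity.\<close>
  then have "dist p z \<le> 2 * (M / real (Suc n))" for n
    by (rule field_le_epsilon)
  moreover have "(\<lambda>n. 2 * (M / real (Suc n))) \<longlonglongrightarrow> 0"
    by (intro tendsto_mult_right_zero LIMSEQ_Suc[OF lim_const_over_n])
  ultimately have "dist p z \<le> 0"
    by (meson LIMSEQ_le_const)
  then show ?thesis by simp
qed

lemma metric_interval_dist_exists:
  fixes x y :: "'a::metric_space"
  assumes mc: "menger_convex TYPE('a)" and s: "s \<in> {0..dist x y}"
  obtains p where "p \<in> metric_interval x y" and "dist x p = s"
proof -
  consider "s = 0" | "s = dist x y" | "0 < s" "s < dist x y" using s by force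
  then show thesis
  proof cases
    case 1
    then show thesis using that[of x] by (simp add: metric_interval_iff)
  next
    case 2
    show thesis by (rule that[of y]) (simp_all add: metric_interval_iff 2)
  next
    case 3
    then have "0 < dist x y" by linarith
    with 3 have "s / dist x y \<in> {0<..<1}" and s: "s / dist x y * dist x y = s" by simp_all
    then obtain p where "p \<in> menger_between x y (s / dist x y)"
      using mc unfolding menger_convex_def by blast
    then have "dist x p \<le> s" "dist p y \<le> dist x y - s"
      unfolding menger_between_def left_diff_distrib s by (simp_all add: dist_commute)
    then have "dist x p = s" "dist x p + dist p y = dist x y"
      using dist_triangle[of x y p] by auto
    then show thesis using that by (simp add: metric_interval_iff)
  qed
qed

text \<open>If \<open>p\<close> is no farther from \<open>x\<close> than \<open>q\<close>, the point
  of \<open>[x,q]\<close> at distance \<open>dist x p\<close> from \<open>x\<close> also lies on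
  \<open>[x,y]\<close>. By uniqueness it is \<open>p\<close>, so \<open>p\<close> lies between
  \<open>x\<close> and \<open>q\<close>.\<close>

lemma metric_interval_isometry:
  fixes x y p q :: "'a::metric_space"
  assumes mc: "menger_convex TYPE('a)" and B': "property_B' TYPE('a)"
    and p: "p \<in> metric_interval x y" and q: "q \<in> metric_interval x y"
  shows "dist (dist x p) (dist x q) = dist p q"
proof -
  have main: "dist p q = dist x q - dist x p"
    if p: "p \<in> metric_interval x y" and q: "q \<in> metric_interval x y"
      and le: "dist x p \<le> dist x q" for p q
  proof -
    obtain r where r: "r \<in> metric_interval x q" "dist x r = dist x p"
      using metric_interval_dist_exists[OF mc, of "dist x p" x q] le by auto
    have "r \<in> metric_interval x y"
      using r q dist_triangle[of r y q] dist_triangle[of x y r] by (simp add: metric_interval_iff)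
    then have "r = p" using metric_interval_unique[OF mc B'] p r by blast
    then show ?thesis using r by (simp add: metric_interval_iff)
  qed
  show ?thesis
    using main[OF p q] main[OF q p] dist_commute[of p q]
    unfolding dist_real_def by linarith
qed

section \<open>Generalized hybrid maps of a compact real interval\<close>

lemma real_generalized_hybridD:
  assumes "generalized_hybrid \<alpha> \<beta> \<gamma> {a..b::real} T"
    and "x \<in> {a..b}" "y \<in> {a..b}" "z \<in> {a..b}"
  shows "\<alpha> * (T x - T y)\<^sup>2 + (1 - \<alpha>) * (x - T y)\<^sup>2 + \<gamma> * (T y - z)\<^sup>2
    \<le> \<beta> * (T x - y)\<^sup>2 + (1 - \<beta> + \<gamma>) * (x - y)\<^sup>2 + (1 + \<gamma>) * (y - z)\<^sup>2"
proof -
  have "\<alpha> * (dist (T x) (T y))\<^sup>2 + (1 - \<alpha>) * (dist x (T y))\<^sup>2 + \<gamma> * (dist (T y) z)\<^sup>2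
    \<le> \<beta> * (dist (T x) y)\<^sup>2 + (1 - \<beta> + \<gamma>) * (dist x y)\<^sup>2 + (1 + \<gamma>) * (dist y z)\<^sup>2"
    using assms unfolding generalized_hybrid_def by blast
  then show ?thesis by (simp only: dist_real_def power2_abs)
qed

lemma real_generalized_hybrid_fixed_point_nonpos:
  fixes T :: "real \<Rightarrow> real"
  assumes hyb: "generalized_hybrid \<alpha> \<beta> \<gamma> {a..b} T" and "\<gamma> \<le> 0"
  shows "\<exists>p\<in>{a..b}. T p = p"
proof -
  have T: "T x \<in> {a..b}" if "x \<in> {a..b}" for x
    using hyb that unfolding generalized_hybrid_def by blast
  have "a \<le> b" using hyb unfolding generalized_hybrid_def by simp
  define X where "X k = (T ^^ k) a" for k
  have X: "X k \<in> {a..b}" for k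
    unfolding X_def using \<open>a \<le> b\<close> by (induction k) (use T in auto)
  have X_Suc: "X (Suc k) = T (X k)" for k by (simp add: X_def)
  \<comment> \<open>A bound for what remains of the \<open>\<alpha>\<close> and
    \<open>\<beta>\<close> terms once they telescope along the orbit.\<close>
  define C where "C = (\<bar>\<alpha>\<bar> + \<bar>\<beta>\<bar>) * (b - a)\<^sup>2"
  have sq: "\<bar>(u - v)\<^sup>2 - (w - v)\<^sup>2\<bar> \<le> (b - a)\<^sup>2" if "u \<in> {a..b}" "v \<in> {a..b}" "w \<in> {a..b}" for u v w
  proof -
    have "(u - v)\<^sup>2 \<le> (b - a)\<^sup>2" "(w - v)\<^sup>2 \<le> (b - a)\<^sup>2"
      using that by (auto intro!: power2_le_iff_abs_le[THEN iffD2])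
    moreover have "(u - v)\<^sup>2 \<ge> 0" "(w - v)\<^sup>2 \<ge> 0" by simp_all
    ultimately show ?thesis by linarith
  qed
  \<comment> \<open>In this form \<open>\<alpha>\<close> and \<open>\<beta>\<close> multiply only
    differences of consecutive terms. The sign of \<open>\<gamma>\<close> permits dropping
    \<open>\<gamma> * (X k - y)\<^sup>2\<close>.\<close>
  have step: "(X k - T y)\<^sup>2 - (X k - y)\<^sup>2 \<le> ((1 + \<gamma>) * (y - z)\<^sup>2 - \<gamma> * (T y - z)\<^sup>2)
      + (\<beta> * ((X (Suc k) - y)\<^sup>2 - (X k - y)\<^sup>2) - \<alpha> * ((X (Suc k) - T y)\<^sup>2 - (X k - T y)\<^sup>2))"
    if "y \<in> {a..b}" "z \<in> {a..b}" for k y z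
  proof -
    have "\<gamma> * (X k - y)\<^sup>2 \<le> 0" using \<open>\<gamma> \<le> 0\<close> by (simp add: mult_nonpos_nonneg)
    then show ?thesis
      using real_generalized_hybridD[OF hyb X[of k] that] by (simp add: X_Suc algebra_simps)
  qed
  define m where "m n = (\<Sum>k<Suc n. X k) / real (Suc n)" for n
  have mean: "(y - T y) * (2 * m n - y - T y)
      \<le> ((1 + \<gamma>) * (y - z)\<^sup>2 - \<gamma> * (T y - z)\<^sup>2) + C / real (Suc n)"
    if y: "y \<in> {a..b}" and z: "z \<in> {a..b}" for n y z
  proof -
    define R where "R = (1 + \<gamma>) * (y - z)\<^sup>2 - \<gamma> * (T y - z)\<^sup>2"
    have "(\<Sum>k<Suc n. (X k - T y)\<^sup>2 - (X k - y)\<^sup>2) \<le> (\<Sum>k<Suc n. R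
      + (\<beta> * ((X (Suc k) - y)\<^sup>2 - (X k - y)\<^sup>2) - \<alpha> * ((X (Suc k) - T y)\<^sup>2 - (X k - T y)\<^sup>2)))"
      unfolding R_def by (intro sum_mono step y z)
    also have "\<dots> = real (Suc n) * R + (\<beta> * ((X (Suc n) - y)\<^sup>2 - (X 0 - y)\<^sup>2)
        - \<alpha> * ((X (Suc n) - T y)\<^sup>2 - (X 0 - T y)\<^sup>2))"
      unfolding sum.distrib sum_subtractf sum_distrib_left[symmetric]
        sum_lessThan_telescope[of "\<lambda>k. (X k - _)\<^sup>2", unfolded sum_subtractf]
      by (simp only: sum_constant card_lessThan)
    also have "\<dots> \<le> real (Suc n) * R + C"
    proof -
      have "\<beta> * ((X (Suc n) - y)\<^sup>2 - (X 0 - y)\<^sup>2) \<le> \<bar>\<beta>\<bar> * (b - a)\<^sup>2"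
        using mult_mono[OF order_refl sq[OF X[of "Suc n"] y X[of 0]], of "\<bar>\<beta>\<bar>"]
        by (simp flip: abs_mult)
      moreover have "- (\<alpha> * ((X (Suc n) - T y)\<^sup>2 - (X 0 - T y)\<^sup>2)) \<le> \<bar>\<alpha>\<bar> * (b - a)\<^sup>2"
        using mult_mono[OF order_refl sq[OF X[of "Suc n"] T[OF y] X[of 0]], of "\<bar>\<alpha>\<bar>"]
        by (simp flip: abs_mult)
      ultimately show ?thesis unfolding C_def distrib_right by linarith
    qed
    \<comment> \<open>The difference of squares is affine in \<open>X k\<close>, so its average is
      its value at the mean \<open>m n\<close>.\<close>
    also have "(\<Sum>k<Suc n. (X k - T y)\<^sup>2 - (X k - y)\<^sup>2)
        = (\<Sum>k<Suc n. (y - T y) * (2 * X k - y - T y))"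
      by (intro sum.cong refl) (simp add: power2_eq_square algebra_simps)
    also have "\<dots> = (y - T y) * (2 * (\<Sum>k<Suc n. X k) - real (Suc n) * (y + T y))"
      by (simp only: sum_distrib_left[symmetric] diff_diff_eq sum_subtractf sum_constant card_lessThan)
    also have "\<dots> = real (Suc n) * ((y - T y) * (2 * m n - y - T y))"
      by (simp add: m_def divide_simps del: sum.lessThan_Suc) (simp add: algebra_simps)
    finally show ?thesis unfolding R_def[symmetric] by (simp add: field_simps)
  qed
  have m: "m n \<in> {a..b}" for n
  proof -
    have "(\<Sum>k<Suc n. X k) \<le> real (card {..<Suc n}) * b" "real (card {..<Suc n}) * a \<le> (\<Sum>k<Suc n. X k)"
      using X by (intro sum_bounded_above sum_bounded_below; simp)+
    then show ?thesis by (simp add: m_def field_simps del: sum.lessThan_Suc)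
  qed
  then obtain l r where l: "l \<in> {a..b}" and r: "strict_mono (r :: nat \<Rightarrow> nat)"
    and lim: "(m \<circ> r) \<longlonglongrightarrow> l"
    using compact_Icc[of a b] unfolding compact_def by metis
  have key: "(l - T l)\<^sup>2 \<le> (1 + \<gamma>) * (l - z)\<^sup>2 - \<gamma> * (T l - z)\<^sup>2" if z: "z \<in> {a..b}" for z
  proof -
    let ?R = "(1 + \<gamma>) * (l - z)\<^sup>2 - \<gamma> * (T l - z)\<^sup>2"
    have "(\<lambda>n. C / real (Suc n)) \<longlonglongrightarrow> 0" by (intro LIMSEQ_Suc[OF lim_const_over_n])
    from LIMSEQ_subseq_LIMSEQ[OF this r]
    have "(\<lambda>n. ?R + C / real (Suc (r n))) \<longlonglongrightarrow> ?R + 0"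
      by (intro tendsto_intros) (simp add: o_def)
    moreover have "(\<lambda>n. (l - T l) * (2 * m (r n) - l - T l)) \<longlonglongrightarrow> (l - T l) * (2 * l - l - T l)"
      using lim by (intro tendsto_intros) (simp add: o_def)
    ultimately have "(l - T l) * (2 * l - l - T l) \<le> ?R + 0"
      using mean[OF l z] by (intro LIMSEQ_le[of "\<lambda>n. (l - T l) * (2 * m (r n) - l - T l)"]) blast+
    then show ?thesis by (simp add: power2_eq_square)
  qed
  \<comment> \<open>Take \<open>z = T l\<close> if \<open>\<gamma> < 0\<close> and
    \<open>z = l\<close> if \<open>\<gamma> = 0\<close>.\<close>
  have "T l = l"
  proof (cases "\<gamma> < 0")
    case True
    have "(l - T l)\<^sup>2 \<le> (1 + \<gamma>) * (l - T l)\<^sup>2" using key[OF T[OF l]] by simp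
    then have "0 \<le> \<gamma> * (l - T l)\<^sup>2" by (simp add: algebra_simps)
    then show ?thesis using True by (simp add: zero_le_mult_iff)
  next
    case False
    then show ?thesis using key[OF l] \<open>\<gamma> \<le> 0\<close> by simp
  qed
  then show ?thesis using l by blast
qed

text \<open>Without a fixed point, the displacement \<open>T x - x\<close> takes opposite signs at
  \<open>s = Sup G\<close> and at points arbitrarily close to \<open>s\<close>. Letting such points
  tend to \<open>s\<close>, in either of the first two arguments of the hybrid inequality, gives two
  inequalities symmetric in the displacement \<open>e\<close> at \<open>s\<close> and a limiting
  displacement \<open>f\<close> with \<open>e * f \<le> 0\<close>.\<close>

lemma real_generalized_hybrid_no_fixed_point_coeff:
  fixes T :: "real \<Rightarrow> real"
  assumes hyb: "generalized_hybrid \<alpha> \<beta> \<gamma> {a..b} T" and "\<gamma> > 0"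
    and nofix: "\<And>x. x \<in> {a..b} \<Longrightarrow> T x \<noteq> x"
  shows "2 * \<bar>\<alpha>\<bar> + 1 + \<gamma> \<le> \<beta> - \<alpha>"
proof -
  have T: "T x \<in> {a..b}" if "x \<in> {a..b}" for x
    using hyb that unfolding generalized_hybrid_def by blast
  have "a \<le> b" using hyb unfolding generalized_hybrid_def by simp
  define G where "G = {x \<in> {a..b}. T x > x}"
  have "a \<in> G" using T[of a] nofix[of a] \<open>a \<le> b\<close> by (auto simp: G_def)
  have bdd: "bdd_above G" by (auto simp: G_def intro!: bdd_aboveI[of _ b])
  define s where "s = Sup G"
  have s: "s \<in> {a..b}"
    unfolding s_def atLeastAtMost_iff
  proof
    show "a \<le> Sup G" using \<open>a \<in> G\<close> bdd by (rule cSup_upper)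
    show "Sup G \<le> b" using \<open>a \<in> G\<close> by (intro cSup_least) (auto simp: G_def)
  qed
  \<comment> \<open>If \<open>s\<close> is in \<open>G\<close>, points to its right are outside
    \<open>G\<close>; otherwise \<open>s\<close> is approached by elements of
    \<open>G\<close>.\<close>
  have "\<exists>Y. (\<forall>n. Y n \<in> {a..b}) \<and> Y \<longlonglongrightarrow> s \<and> (\<forall>n. (T s - s) * (T (Y n) - Y n) < 0)"
  proof (cases "s \<in> G")
    case True
    then have "s \<noteq> b" using T[of b] by (auto simp: G_def)
    then have "s < b" using s by simp
    define Y where "Y n = s + (b - s) / real (Suc n)" for n
    have "s < Y n" "Y n \<le> s + (b - s) / 1" for n
      unfolding Y_def using \<open>s < b\<close> by (simp, intro add_left_mono divide_left_mono) auto
    then have Y: "Y n \<in> {a..b}" "s < Y n" for n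
      using s less_imp_le[of s "Y n"] by (auto intro: order_trans)
    have "Y n \<notin> G" for n
      using cSup_upper[OF _ bdd, of "Y n"] Y(2)[of n] by (auto simp: s_def)
    then have "T (Y n) < Y n" for n
      using nofix[OF Y(1)[of n]] Y(1)[of n] unfolding G_def mem_Collect_eq by (metis linorder_neqE)
    moreover have "Y \<longlonglongrightarrow> s + 0"
      unfolding Y_def by (intro tendsto_intros LIMSEQ_Suc[OF lim_const_over_n])
    ultimately show ?thesis using Y(1) True
      by (intro exI[of _ Y]) (simp add: G_def mult_less_0_iff)
  next
    case False
    then have "T s < s" using nofix[OF s] s by (auto simp: G_def)
    have "\<exists>y\<in>G. s - 1 / real (Suc n) < y" for n
      using less_cSup_iff[OF _ bdd, of "s - 1 / real (Suc n)"] \<open>a \<in> G\<close> by (auto simp: s_def)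
    then obtain Y where Y: "\<And>n. Y n \<in> G" "\<And>n. s - 1 / real (Suc n) < Y n" by metis
    have "Y n \<le> s" for n using cSup_upper[OF Y(1) bdd] by (simp add: s_def)
    have "Y \<longlonglongrightarrow> s"
    proof (rule tendsto_sandwich[of "\<lambda>n. s - 1 / real (Suc n)" _ _ "\<lambda>n. s"])
      show "(\<lambda>n. s - 1 / real (Suc n)) \<longlonglongrightarrow> s"
        using tendsto_diff[OF tendsto_const LIMSEQ_Suc[OF lim_const_over_n[of 1]], of s] by simp
    qed (use Y(2) \<open>\<And>n. Y n \<le> s\<close> in \<open>auto intro!: always_eventually less_imp_le\<close>)
    then show ?thesis using Y(1) \<open>T s < s\<close>
      by (intro exI[of _ Y]) (auto simp: G_def mult_less_0_iff)
  qed
  then obtain Y where Y: "\<And>n. Y n \<in> {a..b}" "Y \<longlonglongrightarrow> s"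
    "\<And>n. (T s - s) * (T (Y n) - Y n) < 0" by blast
  \<comment> \<open>\<open>T\<close> may be discontinuous at \<open>s\<close>, so a limit of the
    values \<open>T (Y n)\<close> is obtained by compactness, along a subsequence.\<close>
  obtain v r where v: "v \<in> {a..b}" and r: "strict_mono (r :: nat \<Rightarrow> nat)"
    and lim: "((\<lambda>n. T (Y n)) \<circ> r) \<longlonglongrightarrow> v"
    using T[OF Y(1)] compact_Icc[of a b, unfolded compact_def, rule_format, of "\<lambda>n. T (Y n)"]
    by blast
  have limT: "(\<lambda>n. T (Y (r n))) \<longlonglongrightarrow> v" using lim by (simp add: o_def)
  have limY: "(\<lambda>n. Y (r n)) \<longlonglongrightarrow> s" using LIMSEQ_subseq_LIMSEQ[OF Y(2) r] by (simp add: o_def)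
  define e where "e = T s - s"
  define f where "f = v - s"
  have "e \<noteq> 0" using nofix[OF s] by (simp add: e_def)
  have ef: "e * f \<le> 0"
  proof -
    have "(\<lambda>n. (T s - s) * (T (Y (r n)) - Y (r n))) \<longlonglongrightarrow> e * f"
      unfolding e_def f_def by (intro tendsto_intros limT limY)
    then show ?thesis using less_imp_le[OF Y(3)] by (intro LIMSEQ_le_const2) blast+
  qed
  have "\<alpha> * (T s - v)\<^sup>2 + (1 - \<alpha>) * (s - v)\<^sup>2 + \<gamma> * (v - s)\<^sup>2
    \<le> \<beta> * (T s - s)\<^sup>2 + (1 - \<beta> + \<gamma>) * (s - s)\<^sup>2 + (1 + \<gamma>) * (s - s)\<^sup>2"
  proof (rule LIMSEQ_le)
    show "\<exists>N. \<forall>n\<ge>N. \<alpha> * (T s - T (Y (r n)))\<^sup>2 + (1 - \<alpha>) * (s - T (Y (r n)))\<^sup>2 + \<gamma> * (T (Y (r n)) - s)\<^sup>2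
      \<le> \<beta> * (T s - Y (r n))\<^sup>2 + (1 - \<beta> + \<gamma>) * (s - Y (r n))\<^sup>2 + (1 + \<gamma>) * (Y (r n) - s)\<^sup>2"
      using real_generalized_hybridD[OF hyb s Y(1) s] by blast
  qed (intro tendsto_intros limT limY)+
  then have 1: "(1 + \<gamma>) * f\<^sup>2 \<le> (\<beta> - \<alpha>) * e\<^sup>2 + 2 * \<alpha> * (e * f)"
    by (simp add: e_def f_def power2_eq_square algebra_simps)
  have "\<alpha> * (v - T s)\<^sup>2 + (1 - \<alpha>) * (s - T s)\<^sup>2 + \<gamma> * (T s - s)\<^sup>2
    \<le> \<beta> * (v - s)\<^sup>2 + (1 - \<beta> + \<gamma>) * (s - s)\<^sup>2 + (1 + \<gamma>) * (s - s)\<^sup>2"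
  proof (rule LIMSEQ_le)
    show "\<exists>N. \<forall>n\<ge>N. \<alpha> * (T (Y (r n)) - T s)\<^sup>2 + (1 - \<alpha>) * (Y (r n) - T s)\<^sup>2 + \<gamma> * (T s - s)\<^sup>2
      \<le> \<beta> * (T (Y (r n)) - s)\<^sup>2 + (1 - \<beta> + \<gamma>) * (Y (r n) - s)\<^sup>2 + (1 + \<gamma>) * (s - s)\<^sup>2"
      using real_generalized_hybridD[OF hyb Y(1) s s] by blast
  qed (intro tendsto_intros limT limY)+
  then have 2: "(1 + \<gamma>) * e\<^sup>2 \<le> (\<beta> - \<alpha>) * f\<^sup>2 + 2 * \<alpha> * (e * f)"
    by (simp add: e_def f_def power2_eq_square algebra_simps)
  have 3: "1 + \<gamma> \<le> \<alpha> + \<beta>"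
  proof -
    have "(1 + \<gamma>) * e\<^sup>2 \<le> (\<alpha> + \<beta>) * e\<^sup>2"
      using real_generalized_hybridD[OF hyb s s s]
      by (simp add: e_def power2_eq_square algebra_simps)
    then show ?thesis using \<open>e \<noteq> 0\<close> by simp
  qed
  show ?thesis
  proof (cases "\<alpha> \<ge> 0")
    case False
    then show ?thesis using 3 by simp
  next
    case True
    define E F where "E = \<bar>e\<bar>" and "F = \<bar>f\<bar>"
    have EF: "E > 0" "F \<ge> 0" using \<open>e \<noteq> 0\<close> by (auto simp: E_def F_def)
    have "e * f = - (E * F)" using ef by (simp add: E_def F_def flip: abs_mult)
    with 1 2 have 1: "(1 + \<gamma>) * F\<^sup>2 + 2 * \<alpha> * (E * F) \<le> (\<beta> - \<alpha>) * E\<^sup>2"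
      and 2: "(1 + \<gamma>) * E\<^sup>2 + 2 * \<alpha> * (E * F) \<le> (\<beta> - \<alpha>) * F\<^sup>2"
      by (simp_all add: E_def F_def)
    \<comment> \<open>Here \<open>P\<close> is the smaller of \<open>E\<close> and \<open>F\<close>:
      replacing \<open>Q\<close> by \<open>P\<close> on the left leaves only multiples of
      \<open>P\<^sup>2\<close>, which can be cancelled. This requires
      \<open>\<alpha> \<ge> 0\<close>; for \<open>\<alpha> < 0\<close> the inequality 3 already is
      the claim or stronger.\<close>
    have gen: "1 + \<gamma> + 2 * \<alpha> \<le> \<beta> - \<alpha>"
      if "P > 0" "P \<le> Q" and *: "(1 + \<gamma>) * Q\<^sup>2 + 2 * \<alpha> * (P * Q) \<le> (\<beta> - \<alpha>) * P\<^sup>2" for P Q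
    proof -
      have "(1 + \<gamma>) * P\<^sup>2 + 2 * \<alpha> * (P * P) \<le> (1 + \<gamma>) * Q\<^sup>2 + 2 * \<alpha> * (P * Q)"
        using that True \<open>\<gamma> > 0\<close> by (intro add_mono mult_left_mono power_mono) auto
      with * have "(1 + \<gamma> + 2 * \<alpha>) * P\<^sup>2 \<le> (\<beta> - \<alpha>) * P\<^sup>2"
        by (simp add: power2_eq_square algebra_simps)
      then show ?thesis using \<open>P > 0\<close> by simp
    qed
    \<comment> \<open>Needed for the cancellation when \<open>F\<close> is the smaller one.\<close>
    have "F \<noteq> 0"
    proof
      assume "F = 0"
      then have "(1 + \<gamma>) * E\<^sup>2 \<le> 0" using 2 by simp
      then show False using EF \<open>\<gamma> > 0\<close> by (simp add: mult_le_0_iff)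
    qed
    then show ?thesis
      using gen[of E F] gen[of F E] 1 2 EF True by (cases "E \<le> F") (auto simp: mult.commute)
  qed
qed

lemma real_generalized_hybrid_fixed_point_pos:
  fixes T :: "real \<Rightarrow> real"
  assumes hyb: "generalized_hybrid \<alpha> \<beta> \<gamma> {a..b} T" and "\<gamma> > 0"
  shows "\<exists>p\<in>{a..b}. T p = p"
proof (rule ccontr)
  assume "\<not> ?thesis"
  then have nofix: "T x \<noteq> x" if "x \<in> {a..b}" for x using that by blast
  have T: "T x \<in> {a..b}" if "x \<in> {a..b}" for x
    using hyb that unfolding generalized_hybrid_def by blast
  have "a \<le> b" using hyb unfolding generalized_hybrid_def by simp
  define c where "c = 1 + 2 * \<bar>\<alpha>\<bar>"
  have coeff: "c + \<gamma> \<le> \<beta> - \<alpha>"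
    using real_generalized_hybrid_no_fixed_point_coeff[OF hyb \<open>\<gamma> > 0\<close> nofix] by (simp add: c_def)
  \<comment> \<open>The growth factor is read off from
    \<open>\<gamma> * E \<le> (F - E) * c\<close>, obtained below for consecutive displacements
    \<open>E\<close> and \<open>F\<close>.\<close>
  define q where "q = 1 + \<gamma> / c"
  have "c \<ge> 1" by (simp add: c_def)
  then have "q > 1" using \<open>\<gamma> > 0\<close> by (simp add: q_def)
  have grow: "q * \<bar>T x - x\<bar> \<le> \<bar>T (T x) - T x\<bar>" if x: "x \<in> {a..b}" for x
  proof -
    define e where "e = T x - x"
    define f where "f = T (T x) - T x"
    define E F where "E = \<bar>e\<bar>" and "F = \<bar>f\<bar>"
    have "E > 0" "F \<ge> 0" using nofix[OF x] by (auto simp: E_def F_def e_def)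
    have "(1 + \<gamma>) * f\<^sup>2 + 2 * (1 - \<alpha>) * (e * f) \<le> (\<gamma> + \<alpha> - \<beta>) * e\<^sup>2"
      using real_generalized_hybridD[OF hyb x T[OF x] T[OF x]]
      by (simp add: e_def f_def power2_eq_square algebra_simps)
    also have "\<dots> \<le> (- c) * e\<^sup>2"
      using coeff by (intro mult_right_mono) auto
    finally have 1: "(1 + \<gamma>) * f\<^sup>2 + c * e\<^sup>2 \<le> 2 * ((\<alpha> - 1) * (e * f))"
      by (simp add: algebra_simps)
    have "(\<alpha> - 1) * (e * f) \<le> \<bar>\<alpha> - 1\<bar> * (E * F)"
      by (metis E_def F_def abs_ge_self abs_mult)
    also have "\<dots> \<le> (1 + \<bar>\<alpha>\<bar>) * (E * F)"
      using \<open>E > 0\<close> \<open>F \<ge> 0\<close> by (intro mult_right_mono) auto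
    finally have "(1 + \<gamma>) * F\<^sup>2 + c * E\<^sup>2 \<le> (1 + c) * (E * F)"
      using 1 by (simp add: E_def F_def c_def algebra_simps)
    \<comment> \<open>The factorization shows that \<open>F\<close> cannot be below
      \<open>E\<close>: as \<open>c \<ge> 1\<close>, the right side would be negative.\<close>
    then have 2: "\<gamma> * F\<^sup>2 \<le> (F - E) * (c * E - F)"
      by (simp add: power2_eq_square algebra_simps)
    have "E \<le> F"
    proof (rule ccontr)
      assume "\<not> E \<le> F"
      moreover have "E \<le> c * E" using \<open>c \<ge> 1\<close> \<open>E > 0\<close> by simp
      ultimately have "(F - E) * (c * E - F) < 0" by (intro mult_neg_pos) auto
      moreover have "0 \<le> \<gamma> * F\<^sup>2" using \<open>\<gamma> > 0\<close> by simp
      ultimately show False using 2 by linarith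
    qed
    have "\<gamma> * E\<^sup>2 \<le> \<gamma> * F\<^sup>2" using \<open>E \<le> F\<close> \<open>E > 0\<close> \<open>\<gamma> > 0\<close> by simp
    also note 2
    also have "(F - E) * (c * E - F) \<le> (F - E) * (c * E)"
      using \<open>E \<le> F\<close> \<open>F \<ge> 0\<close> by (intro mult_left_mono) auto
    finally have "\<gamma> * E * E \<le> (F - E) * c * E" by (simp add: power2_eq_square algebra_simps)
    then have "\<gamma> * E \<le> (F - E) * c" using \<open>E > 0\<close> by simp
    then have "q * E \<le> F" using \<open>c \<ge> 1\<close> by (simp add: q_def field_simps)
    then show ?thesis by (simp add: E_def F_def e_def f_def)
  qed
  define X where "X k = (T ^^ k) a" for k
  have X: "X k \<in> {a..b}" for k
    unfolding X_def using \<open>a \<le> b\<close> by (induction k) (use T in auto)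
  have "q ^ k * \<bar>T a - a\<bar> \<le> \<bar>T (X k) - X k\<bar>" for k
  proof (induction k)
    case 0
    then show ?case by (simp add: X_def)
  next
    case (Suc k)
    have "q ^ Suc k * \<bar>T a - a\<bar> \<le> q * \<bar>T (X k) - X k\<bar>"
      using Suc \<open>q > 1\<close> by (simp add: mult.assoc)
    also have "\<dots> \<le> \<bar>T (X (Suc k)) - X (Suc k)\<bar>"
      using grow[OF X[of k]] by (simp add: X_def)
    finally show ?case .
  qed
  moreover have "\<bar>T (X k) - X k\<bar> \<le> b - a" for k
    using X[of k] T[OF X[of k]] by auto
  ultimately have bound: "q ^ k * \<bar>T a - a\<bar> \<le> b - a" for k
    by (meson order_trans)
  have "\<bar>T a - a\<bar> > 0" using nofix[of a] \<open>a \<le> b\<close> by simp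
  obtain k where "(b - a) / \<bar>T a - a\<bar> < q ^ k"
    using real_arch_pow[OF \<open>q > 1\<close>] by blast
  then show False using bound[of k] \<open>\<bar>T a - a\<bar> > 0\<close> by (simp add: field_simps)
qed

section \<open>Transfer from the real interval to the metric interval\<close>

theorem theorem5p11:
  fixes x y :: "'a::complete_space"
    and T :: "'a \<Rightarrow> 'a"
    and \<alpha> \<beta> \<gamma> :: real
  assumes "menger_convex TYPE('a)"
    and "property_B'_printed TYPE('a) \<or> property_B' TYPE('a)"
    and "menger_convex_dist TYPE('a)"
    and "x \<noteq> y"
    and "menger_convex_set (metric_interval x y)"
    and "generalized_hybrid \<alpha> \<beta> \<gamma> (metric_interval x y) T"
  shows "\<exists>p\<in>metric_interval x y. T p = p"
proof -
  note mc = assms(1)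
  have B': "property_B' TYPE('a)" using assms(1,2) property_B'_if_printed by blast
  let ?U = "metric_interval x y" and ?I = "{0..dist x y}"
  have T: "T p \<in> ?U" if "p \<in> ?U" for p
    using assms(6) that unfolding generalized_hybrid_def by blast
  have "\<forall>s\<in>?I. \<exists>p\<in>?U. dist x p = s"
    using metric_interval_dist_exists[OF mc] by metis
  then obtain g where g: "\<And>s. s \<in> ?I \<Longrightarrow> g s \<in> ?U" "\<And>s. s \<in> ?I \<Longrightarrow> dist x (g s) = s"
    by metis
  \<comment> \<open>\<open>S\<close> is \<open>T\<close> conjugated by the isometry
    \<open>dist x\<close>, with \<open>g\<close> as its inverse. The hybrid inequality involves
    distances only, so it passes to \<open>S\<close> with the same coefficients.\<close>
  define S where "S s = dist x (T (g s))" for s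
  note iso = metric_interval_isometry[OF mc B']
  have "generalized_hybrid \<alpha> \<beta> \<gamma> ?I S"
    unfolding generalized_hybrid_def
  proof (intro conjI ballI)
    show "?I \<noteq> {}" by simp
    have "dist x p \<le> dist x y" if "p \<in> ?U" for p
      using that zero_le_dist[of p y] unfolding metric_interval_iff by linarith
    then show "S \<in> ?I \<rightarrow> ?I" using T g(1) by (auto simp: S_def)
  next
    fix s t u assume I: "s \<in> ?I" "t \<in> ?I" "u \<in> ?I"
    have "dist (S s) (S t) = dist (T (g s)) (T (g t))" "dist s (S t) = dist (g s) (T (g t))"
      "dist (S t) u = dist (T (g t)) (g u)" "dist (S s) t = dist (T (g s)) (g t)"
      "dist s t = dist (g s) (g t)" "dist t u = dist (g t) (g u)"
      using I iso[OF T[OF g(1)] T[OF g(1)]] iso[OF g(1) T[OF g(1)]] iso[OF T[OF g(1)] g(1)]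
        iso[OF g(1) g(1)] g(2) by (metis S_def)+
    then show "\<alpha> * (dist (S s) (S t))\<^sup>2 + (1 - \<alpha>) * (dist s (S t))\<^sup>2 + \<gamma> * (dist (S t) u)\<^sup>2
        \<le> \<beta> * (dist (S s) t)\<^sup>2 + (1 - \<beta> + \<gamma>) * (dist s t)\<^sup>2 + (1 + \<gamma>) * (dist t u)\<^sup>2"
      using assms(6) g(1) I unfolding generalized_hybrid_def by presburger
  qed
  then obtain s where s: "s \<in> ?I" "S s = s"
    using real_generalized_hybrid_fixed_point_nonpos real_generalized_hybrid_fixed_point_pos
    by (metis linorder_not_le)
  have "dist (T (g s)) (g s) = dist (S s) s"
    using iso[OF T[OF g(1)[OF s(1)]] g(1)[OF s(1)]] g(2)[OF s(1)] by (simp add: S_def)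
  then have "T (g s) = g s" using s(2) by simp
  then show ?thesis using g(1)[OF s(1)] by blast
qed

end
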